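(* Let $n \ge 2$ be an integer and let $S$ be a dense subset of $\mathbb{R}$ which is closed under powering. Then $\mathcal{M}_n(S)$ is dense in $\mathbb{R}^n$.
   Context: A subset $S$ of a ring $R$ is closed under powering if for any $\alpha \in S$ we also have $\alpha^m \in S$ for every non-zero integer $m$ (for $\alpha = 0$ this is required only for positive $m$, where $\alpha^m$ is defined). A vector $\mathbf{v}=(v_1,\dots,v_n)\in\mathbb{R}^n$ is multiplicatively dependent if all its coordinates are non-zero and there is a non-zero integer vector $(k_1,\dots,k_n)\in\mathbb{Z}^n$ with $v_1^{k_1}\cdots v_n^{k_n}=1$. For $S\subseteq\mathbb{R}$, $\mathcal{M}_n(S)$ denotes the set of multiplicatively dependent vectors in $\mathbb{R}^n$ all of whose coordinates lie in $S$. *)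

theory Defs
  imports "HOL-Analysis.Analysis"
begin

(* In HOL, 0 powi m = 0 also for m < 0; the guard restricts the condition at 0 to the
   exponents for which the power is mathematically defined. *)
definition closed_under_powering :: "'a::field set \<Rightarrow> bool" where
  "closed_under_powering S \<longleftrightarrow>
     (\<forall>\<alpha>\<in>S. \<forall>m::int. m \<noteq> 0 \<longrightarrow> (\<alpha> \<noteq> 0 \<or> m > 0) \<longrightarrow> \<alpha> powi m \<in> S)"

definition mult_dependent :: "real ^ 'n \<Rightarrow> bool" where
  "mult_dependent v \<longleftrightarrow>
     (\<forall>i. v $ i \<noteq> 0) \<and> (\<exists>k :: int ^ 'n. k \<noteq> 0 \<and> (\<Prod>i\<in>UNIV. (v $ i) powi (k $ i)) = 1)"

definition mult_dependent_vectors :: "real set \<Rightarrow> (real ^ 'n) set" where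
  "mult_dependent_vectors S = {v. mult_dependent v \<and> (\<forall>i. v $ i \<in> S)}"

end

theory Submission
  imports Defs "HOL-Real_Asymp.Real_Asymp"
begin

text \<open>
  Any two nonzero reals x, y with absolute value different from 1 are approximated by powers
  of one negative base t, with exponents p, q whose parities give the right signs: t is chosen
  with t^p = x exactly, and q/p close to ln |y| / ln |x| makes t^q close to y. Replacing t by a
  nearby s in S keeps both approximations and gives the multiplicatively dependent pair
  (s^p, s^q) in S; the other coordinates are arbitrary.
\<close>

text \<open>In a perfect space a nonempty open set is infinite, so finitely many exceptional values
  can always be avoided.\<close>

lemma open_minus_finite_nonempty:
  fixes A :: "'a::{real_normed_vector,perfect_space} set"
  assumes "open A" "A \<noteq> {}" "finite F"
  shows "open (A - F)" "A - F \<noteq> {}"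
proof -
  show "open (A - F)"
    using assms by (simp add: finite_imp_closed open_Diff)
  show "A - F \<noteq> {}"
  proof
    assume "A - F = {}"
    then have "finite A" using assms(3) by (simp add: Diff_eq_empty_iff finite_subset)
    then show False using assms(1,2) finite_imp_not_open by blast
  qed
qed

lemma dense_meets_open_minus_finite:
  fixes S :: "'a::{real_normed_vector,perfect_space} set"
  assumes "closure S = UNIV" "open A" "A \<noteq> {}" "finite F"
  obtains s where "s \<in> S" "s \<in> A" "s \<notin> F"
proof -
  note AF = open_minus_finite_nonempty[OF assms(2-4)]
  have "(A - F) \<inter> S \<noteq> {}"
    using open_Int_closure_eq_empty[OF AF(1), of S] AF(2) assms(1) by simp
  then show thesis using that by blast
qed

text \<open>The offsets \<open>a\<close>, \<open>b\<close> and the rounding error stay bounded while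
  \<open>k\<close> grows, so fixing the parities of both integers costs nothing in the
  limit.\<close>

lemma ratio_tendsto_prescribed_parity:
  fixes r :: real and a b :: int
  shows "(\<lambda>k::nat. real_of_int (2 * \<lfloor>r * real k\<rfloor> + b) / real_of_int (2 * int k + a))
    \<longlonglongrightarrow> r"
proof -
  have "(\<lambda>k::nat. (2 * real_of_int \<lfloor>r * real k\<rfloor> + real_of_int b) / (2 * real k + real_of_int a))
    \<longlonglongrightarrow> r"
    by real_asymp
  then show ?thesis by simp
qed

lemma minus_powi_parity:
  fixes u :: real
  assumes "u > 0"
  shows "(- u) powi (2 * m) = u powr real_of_int (2 * m)"
    and "(- u) powi (2 * m + 1) = - (u powr real_of_int (2 * m + 1))"
proof -
  show *: "(- u) powi (2 * m) = u powr real_of_int (2 * m)"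
    using assms by (simp add: powr_real_of_int' del: of_int_mult)
  show "(- u) powi (2 * m + 1) = - (u powr real_of_int (2 * m + 1))"
    using assms by (simp add: powr_real_of_int' del: of_int_mult of_int_add)
qed

lemma common_base_in_open_sets:
  fixes A B :: "real set"
  assumes A: "open A" "A \<noteq> {}" and B: "open B" "B \<noteq> {}"
  obtains t :: real and p q :: int
  where "t \<noteq> 0" "p \<noteq> 0" "q \<noteq> 0" "t powi p \<in> A" "t powi q \<in> B"
proof -
  \<comment> \<open>Excluding 0 and both units makes the two logarithms finite and nonzero, so
    \<open>r\<close> is defined and nonzero.\<close>
  obtain x where x: "x \<in> A" "x \<notin> {0,1,-1}"
    using open_minus_finite_nonempty(2)[OF A, of "{0,1,-1}"] by auto
  obtain y where y: "y \<in> B" "y \<notin> {0,1,-1}"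
    using open_minus_finite_nonempty(2)[OF B, of "{0,1,-1}"] by auto
  define r where "r = ln \<bar>y\<bar> / ln \<bar>x\<bar>"
  have lnx: "ln \<bar>x\<bar> \<noteq> 0" and lny: "ln \<bar>y\<bar> \<noteq> 0"
    using x(2) y(2) by (auto simp: abs_if split: if_splits)
  then have r0: "r \<noteq> 0" by (simp add: r_def)
  have xr: "\<bar>x\<bar> powr r = \<bar>y\<bar>"
    using x(2) y(2) lnx by (simp add: r_def powr_def)
  \<comment> \<open>The base will be negative, so an exponent has to be odd exactly when its target
    is negative.\<close>
  define a b :: int where "a = (if x < 0 then 1 else 0)" and "b = (if y < 0 then 1 else 0)"
  define p q :: "nat \<Rightarrow> int"
    where "p k = 2 * int k + a" and "q k = 2 * \<lfloor>r * real k\<rfloor> + b" for k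
  have lim: "(\<lambda>k. real_of_int (q k) / real_of_int (p k)) \<longlonglongrightarrow> r"
    unfolding p_def q_def by (rule ratio_tendsto_prescribed_parity)
  have "(\<lambda>k. sgn y * \<bar>x\<bar> powr (q k / p k)) \<longlonglongrightarrow> sgn y * \<bar>x\<bar> powr r"
    using x(2) by (intro tendsto_intros lim) auto
  then have "(\<lambda>k. sgn y * \<bar>x\<bar> powr (q k / p k)) \<longlonglongrightarrow> y"
    by (simp add: xr sgn_mult_abs)
  then have "\<forall>\<^sub>F k in sequentially. sgn y * \<bar>x\<bar> powr (q k / p k) \<in> B"
    using B(1) y(1) topological_tendstoD by blast
  \<comment> \<open>Since division by zero gives 0, a nonzero quotient rules out both
    \<open>p k = 0\<close> and \<open>q k = 0\<close>.\<close>
  moreover have "\<forall>\<^sub>F k in sequentially. real_of_int (q k) / real_of_int (p k) \<noteq> 0"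
    using lim r0 by (rule tendsto_imp_eventually_ne)
  ultimately have "\<forall>\<^sub>F k in sequentially. sgn y * \<bar>x\<bar> powr (q k / p k) \<in> B \<and>
      real_of_int (q k) / real_of_int (p k) \<noteq> 0"
    by (rule eventually_conj)
  then obtain k where k: "sgn y * \<bar>x\<bar> powr (q k / p k) \<in> B"
      "real_of_int (q k) / real_of_int (p k) \<noteq> 0"
    using eventually_happens'[OF sequentially_bot] by blast
  then have pq: "p k \<noteq> 0" "q k \<noteq> 0" by auto
  \<comment> \<open>With this root of \<open>\<bar>x\<bar>\<close>, the base \<open>- u\<close> hits
    \<open>x\<close> exactly at exponent \<open>p k\<close>; only \<open>y\<close> is
    approximated.\<close>
  define u where "u = \<bar>x\<bar> powr (1 / p k)"
  have u: "u > 0" using x(2) by (simp add: u_def)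
  have "u powr p k = \<bar>x\<bar>" "u powr q k = \<bar>x\<bar> powr (q k / p k)"
    using x(2) pq by (simp_all add: u_def powr_powr)
  moreover have "(- u) powi p k = sgn x * u powr p k"
    using x(2) minus_powi_parity[OF u, of "int k"] by (auto simp: p_def a_def sgn_if)
  moreover have "(- u) powi q k = sgn y * u powr q k"
    using y(2) minus_powi_parity[OF u, of "\<lfloor>r * real k\<rfloor>"] by (auto simp: q_def b_def sgn_if)
  ultimately have "(- u) powi p k \<in> A" "(- u) powi q k \<in> B"
    using x(1) k(1) by (simp_all add: sgn_mult_abs)
  then show thesis using that[of "- u" "p k" "q k"] u pq by auto
qed

lemma common_base_in_dense_set:
  fixes A B S :: "real set"
  assumes S: "closure S = UNIV" and AB: "open A" "A \<noteq> {}" "open B" "B \<noteq> {}"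
  obtains s :: real and p q :: int
  where "s \<in> S" "s \<noteq> 0" "p \<noteq> 0" "q \<noteq> 0" "s powi p \<in> A" "s powi q \<in> B"
proof -
  obtain t p q where t: "t \<noteq> 0" "p \<noteq> 0" "q \<noteq> 0" "t powi p \<in> A" "t powi q \<in> B"
    using common_base_in_open_sets[OF AB] by blast
  \<comment> \<open>Continuity at \<open>t\<close> also for negative exponents, because
    \<open>t\<close> is nonzero; hence the same \<open>p\<close> and \<open>q\<close> serve all
    bases near \<open>t\<close>.\<close>
  have "((\<lambda>s. s powi m) \<longlongrightarrow> t powi m) (nhds t)" for m
    using t(1) by (intro tendsto_intros) (simp_all add: filterlim_ident)
  then have "\<forall>\<^sub>F s in nhds t. s powi p \<in> A \<and> s powi q \<in> B"
    using t AB by (intro eventually_conj) (auto dest: topological_tendstoD)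
  then obtain U where U: "open U" "t \<in> U" "\<And>s. s \<in> U \<Longrightarrow> s powi p \<in> A \<and> s powi q \<in> B"
    unfolding eventually_nhds by blast
  obtain s where "s \<in> S" "s \<in> U" "s \<notin> {0}"
    using dense_meets_open_minus_finite[OF S U(1), of "{0}"] U(2) by blast
  then show thesis using that t U(3) by blast
qed

theorem theorem1p1:
  fixes S :: "real set"
  assumes "CARD('n::finite) \<ge> 2"
    and "closure S = UNIV"
    and "closed_under_powering S"
  shows "closure (mult_dependent_vectors S :: (real ^ 'n) set) = UNIV"
proof -
  obtain i j :: 'n where ij: "i \<noteq> j"
    using assms(1) ex_card[of 2 "UNIV :: 'n set"] by (auto simp: card_2_iff)
  have "\<exists>v \<in> mult_dependent_vectors S. v \<in> U" if U: "open U" "x \<in> U" for U and x :: "real ^ 'n"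
  proof -
    obtain A where A: "\<And>l. open (A l)" "\<And>l. x $ l \<in> A l" "\<And>y. (\<And>l. y $ l \<in> A l) \<Longrightarrow> y \<in> U"
      using U unfolding open_vec_def by metis
    then have ne: "A l \<noteq> {}" for l by blast
    obtain s p q where s: "s \<in> S" "s \<noteq> 0" "p \<noteq> 0" "q \<noteq> 0" "s powi p \<in> A i" "s powi q \<in> A j"
      using common_base_in_dense_set[OF assms(2) A(1) ne A(1) ne] by blast
    have "\<exists>w. w \<in> S \<and> w \<in> A l \<and> w \<noteq> 0" for l
      using dense_meets_open_minus_finite[OF assms(2) A(1) ne, of "{0}"] by blast
    then obtain w where w: "\<And>l. w l \<in> S" "\<And>l. w l \<in> A l" "\<And>l. w l \<noteq> 0" by metis
    define v :: "real ^ 'n"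
      where "v = (\<chi> l. if l = i then s powi p else if l = j then s powi q else w l)"
    \<comment> \<open>Crossing the exponents gives the relation
      \<open>(s powi p) powi q * (s powi q) powi (- p) = 1\<close>.\<close>
    define k :: "int ^ 'n" where "k = (\<chi> l. if l = i then q else if l = j then - p else 0)"
    have "(\<Prod>l\<in>UNIV. (v $ l) powi (k $ l)) = (\<Prod>l\<in>{i, j}. (v $ l) powi (k $ l))"
      by (rule prod.mono_neutral_right) (auto simp: k_def)
    also have "\<dots> = (s powi p) powi q * (s powi q) powi (- p)"
      using ij by (auto simp: v_def k_def)
    also have "\<dots> = 1"
      using s(2) by (simp add: power_int_minus flip: power_int_mult) (simp add: mult.commute)
    finally have "(\<Prod>l\<in>UNIV. (v $ l) powi (k $ l)) = 1" .
    moreover have "k \<noteq> 0"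
      using s(4) by (auto simp: k_def vec_eq_iff)
    \<comment> \<open>Closure under powering enters here: it puts the entries at \<open>i\<close>
      and \<open>j\<close> in \<open>S\<close>, as \<open>s\<close>, \<open>p\<close> and
      \<open>q\<close> are nonzero.\<close>
    moreover have "v $ l \<noteq> 0" "v $ l \<in> S" "v $ l \<in> A l" for l
      using s w assms(3) by (auto simp: v_def closed_under_powering_def)
    ultimately have "v \<in> mult_dependent_vectors S" "v \<in> U"
      using A(3) by (auto simp: mult_dependent_vectors_def mult_dependent_def)
    then show ?thesis by blast
  qed
  \<comment> \<open>The complement of the closure is open, so a point in it would yield a dependent
    vector outside the closure.\<close>
  from this[of "- closure (mult_dependent_vectors S)"] show ?thesis
    using closure_subset[of "mult_dependent_vectors S :: (real ^ 'n) set"] by auto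
qed

end
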